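(* Let $V$ be a valuation domain of rank one with quotient field $K$ and value group $\Gamma_v\subseteq\mathbb{R}$. The following hold. (a) For every $\delta\in\Gamma_v$, the set $\mathcal{V}_{\mathrm{stat}}(\bullet,\delta)=\{V_E\mid E\text{ is a pseudo-stationary sequence in }K\text{ with }\delta_E=\delta\}$ is discrete, with respect to the Zariski and the constructible topology. (b) For every $\beta\in K$, the set $\mathcal{V}_{\mathrm{stat}}(\beta,\bullet)=\{V_E\mid E\text{ is a pseudo-stationary sequence in }K\text{ with }\beta\in\mathcal{L}_E\}$ is discrete, with respect to the Zariski and the constructible topology.
   Context: $\mathrm{Zar}(K(X)|V)$ is the set of valuation domains of $K(X)$ (with quotient field $K(X)$) containing $V$. Its Zariski topology is generated by the subbasic open sets $B(\phi)=\{W\mid\phi\in W\}$, $\phi\in K(X)$; its constructible topology is the coarsest topology for which all sets $B(\phi_1)\cap\cdots\cap B(\phi_k)$ are both open and closed. Subsets carry the subspace topologies. $v$ is the valuation associated to $V$. A sequence $E=\{s_n\}_{n\in\mathbb{N}}$ of (pairwise distinct) elements of $K$ is pseudo-stationary if $v(s_n-s_m)=v(s_{n'}-s_{m'})$ for all $n\neq m$, $n'\neq m'$; this common value is the breadth $\delta_E\in\Gamma_v$ of $E$. For such $E$, $V_E=\{\phi\in K(X)\mid\phi(s_n)\in V\text{ for all but finitely many }n\in\mathbb{N}\}$ is a valuation domain of $K(X)$ extending $V$. The set of pseudo-limits of $E$ is the set $\mathcal{L}_E$ of the $\alpha\in K$ such that $v(\alpha-s_n)=\delta_E$ for all large $n$;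 equivalently, $\mathcal{L}_E=\{x\in K\mid v(x-s_0)\geq\delta_E\}=s_0+cV$, where $v(c)=\delta_E$. *)

theory Defs
  imports
    "HOL-Analysis.Analysis"
    "HOL-Computational_Algebra.Polynomial"
    "HOL-Computational_Algebra.Fraction_Field"
begin

section \<open>Valuation domains\<close>

text \<open>
  Valuation domains are subsets of a field type, and the quotient field is the whole type.
  The field itself counts as a (trivial) valuation domain.
\<close>

definition valuation_domain :: "'a::field set \<Rightarrow> bool" where
  "valuation_domain W \<longleftrightarrow>
     1 \<in> W \<and> (\<forall>x\<in>W. \<forall>y\<in>W. x - y \<in> W \<and> x * y \<in> W) \<and>
     (\<forall>x. x \<noteq> 0 \<longrightarrow> x \<in> W \<or> inverse x \<in> W)"

definition prime_ideal_of :: "'a::field set \<Rightarrow> 'a set \<Rightarrow> bool" where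
  "prime_ideal_of V P \<longleftrightarrow>
     P \<subseteq> V \<and> 0 \<in> P \<and> 1 \<notin> P \<and>
     (\<forall>x\<in>P. \<forall>y\<in>P. x + y \<in> P) \<and> (\<forall>a\<in>V. \<forall>x\<in>P. a * x \<in> P) \<and>
     (\<forall>a\<in>V. \<forall>b\<in>V. a * b \<in> P \<longrightarrow> a \<in> P \<or> b \<in> P)"

text \<open>
  The prime ideals of a valuation domain form a chain, so its rank (Krull dimension) is one
  iff there is exactly one nonzero prime ideal.
\<close>

definition rank_one :: "'a::field set \<Rightarrow> bool" where
  "rank_one V \<longleftrightarrow> (\<exists>!P. prime_ideal_of V P \<and> P \<noteq> {0})"

text \<open>\<open>v\<close> is a valuation associated to \<open>V\<close> whose value group lies in the reals.\<close>

definition associated_real_valuation :: "'a::field set \<Rightarrow> ('a \<Rightarrow> ereal) \<Rightarrow> bool" where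
  "associated_real_valuation V v \<longleftrightarrow>
     v 0 = \<infinity> \<and> (\<forall>x. x \<noteq> 0 \<longrightarrow> \<bar>v x\<bar> \<noteq> \<infinity>) \<and>
     (\<forall>x y. v (x * y) = v x + v y) \<and> (\<forall>x y. min (v x) (v y) \<le> v (x + y)) \<and>
     V = {x. 0 \<le> v x}"

definition value_group :: "('a::field \<Rightarrow> ereal) \<Rightarrow> real set" where
  "value_group v = {g. \<exists>x. x \<noteq> 0 \<and> v x = ereal g}"


section \<open>Rational functions\<close>

type_synonym 'a ratfun = "'a poly fract"

definition const_ratfun :: "'a::field \<Rightarrow> 'a ratfun" where
  "const_ratfun a = Fract [:a:] 1"

text \<open>
  A rational function is defined at a point iff some representation as a fraction has a
  denominator that does not vanish there. The value does not depend on the representation.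
\<close>

definition defined_at :: "'a::field ratfun \<Rightarrow> 'a \<Rightarrow> bool" where
  "defined_at \<phi> a \<longleftrightarrow> (\<exists>p q. \<phi> = Fract p q \<and> poly q a \<noteq> 0)"

definition ratfun_eval :: "'a::field ratfun \<Rightarrow> 'a \<Rightarrow> 'a" where
  "ratfun_eval \<phi> a = (THE y. \<exists>p q. \<phi> = Fract p q \<and> poly q a \<noteq> 0 \<and> y = poly p a / poly q a)"

lemma ratfun_eval_Fract:
  fixes p q :: "'a::field poly"
  assumes "poly q a \<noteq> 0"
  shows "ratfun_eval (Fract p q) a = poly p a / poly q a"
  unfolding ratfun_eval_def
proof (rule the_equality)
  show "\<exists>p' q'. Fract p q = Fract p' q' \<and> poly q' a \<noteq> 0 \<and>
          poly p a / poly q a = poly p' a / poly q' a"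
    using assms by blast
next
  fix y assume "\<exists>p' q'. Fract p q = Fract p' q' \<and> poly q' a \<noteq> 0 \<and> y = poly p' a / poly q' a"
  then obtain p' q' where eq: "Fract p q = Fract p' q'" and q': "poly q' a \<noteq> 0"
    and y: "y = poly p' a / poly q' a" by blast
  have "q \<noteq> 0" "q' \<noteq> 0" using assms q' by auto
  then have "p * q' = p' * q" using eq by (simp add: eq_fract)
  then have "poly p a * poly q' a = poly p' a * poly q a" by (metis poly_mult)
  then show "y = poly p a / poly q a" using assms q' y by (simp add: frac_eq_eq)
qed


section \<open>The Zariski space of \<open>K(X)\<close> over \<open>V\<close>\<close>

definition Zar :: "'a::field set \<Rightarrow> 'a ratfun set set" where
  "Zar V = {W. valuation_domain W \<and> const_ratfun ` V \<subseteq> W}"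

definition basic_open :: "'a::field set \<Rightarrow> 'a ratfun \<Rightarrow> 'a ratfun set set" where
  "basic_open V \<phi> = {W \<in> Zar V. \<phi> \<in> W}"

definition zariski_topology :: "'a::field set \<Rightarrow> 'a ratfun set topology" where
  "zariski_topology V = topology_generated_by (range (basic_open V))"

definition finite_basic_sets :: "'a::field set \<Rightarrow> 'a ratfun set set set" where
  "finite_basic_sets V = {\<Inter>\<phi>\<in>F. basic_open V \<phi> | F. finite F \<and> F \<noteq> {}}"

text \<open>
  Closedness of a set is openness of its complement in \<open>Zar V\<close>, hence the coarsest
  topology making the sets above clopen is generated by them and their complements.
\<close>

definition constructible_topology :: "'a::field set \<Rightarrow> 'a ratfun set topology" where
  "constructible_topology V = topology_generated_by
     (finite_basic_sets V \<union> (\<lambda>U. Zar V - U) ` finite_basic_sets V)"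

definition discrete_subspace :: "'b topology \<Rightarrow> 'b set \<Rightarrow> bool" where
  "discrete_subspace T S \<longleftrightarrow> subtopology T S = discrete_topology S"


section \<open>Pseudo-stationary sequences\<close>

definition pseudo_stationary :: "('a::field \<Rightarrow> ereal) \<Rightarrow> (nat \<Rightarrow> 'a) \<Rightarrow> bool" where
  "pseudo_stationary v s \<longleftrightarrow>
     inj s \<and> (\<forall>n m n' m'. n \<noteq> m \<longrightarrow> n' \<noteq> m' \<longrightarrow> v (s n - s m) = v (s n' - s m'))"

definition breadth :: "('a::field \<Rightarrow> ereal) \<Rightarrow> (nat \<Rightarrow> 'a) \<Rightarrow> ereal" where
  "breadth v s = (THE d. \<forall>n m. n \<noteq> m \<longrightarrow> v (s n - s m) = d)"

definition pseudo_limits :: "('a::field \<Rightarrow> ereal) \<Rightarrow> (nat \<Rightarrow> 'a) \<Rightarrow> 'a set" where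
  "pseudo_limits v s = {\<alpha>. \<forall>\<^sub>F n in sequentially. v (\<alpha> - s n) = breadth v s}"

definition seq_domain :: "'a::field set \<Rightarrow> (nat \<Rightarrow> 'a) \<Rightarrow> 'a ratfun set" where
  "seq_domain V s = {\<phi>. \<forall>\<^sub>\<infinity>n. defined_at \<phi> (s n) \<and> ratfun_eval \<phi> (s n) \<in> V}"

definition V_stat_breadth :: "'a::field set \<Rightarrow> ('a \<Rightarrow> ereal) \<Rightarrow> real \<Rightarrow> 'a ratfun set set" where
  "V_stat_breadth V v \<delta> = {seq_domain V s | s. pseudo_stationary v s \<and> breadth v s = ereal \<delta>}"

definition V_stat_limit :: "'a::field set \<Rightarrow> ('a \<Rightarrow> ereal) \<Rightarrow> 'a \<Rightarrow> 'a ratfun set set" where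
  "V_stat_limit V v \<beta> = {seq_domain V s | s. pseudo_stationary v s \<and> \<beta> \<in> pseudo_limits v s}"

end

theory Submission
  imports Defs
begin

text \<open>
  A polynomial \<open>p\<close> whose value is at least \<open>g\<close> at more than \<open>degree p\<close> points of a disc of
  radius \<open>\<delta>\<close>, with pairwise distances exactly \<open>\<delta>\<close>, has value at least \<open>g\<close> on the whole disc.
  Hence along every pseudo-stationary sequence of breadth \<open>\<delta>\<close> in the disc the value of \<open>p\<close> is
  eventually the minimum of its values on the disc, so \<open>V\<^sub>E\<close> depends on the disc only.
  For fixed breadth \<open>\<delta> = v c\<close> the function \<open>(X - s\<^sub>0) / c\<close> isolates \<open>V\<^sub>E\<close>, and for a fixed
  pseudo-limit \<open>\<beta>\<close> the function \<open>(X - \<beta>) / c + c / (X - \<beta>)\<close> does: at a point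
  with \<open>v (t - \<beta>) \<noteq> v c\<close> the two summands have opposite nonzero values.
\<close>

section \<open>Discrete subspaces of the Zariski space\<close>

lemma discrete_subspaceI:
  assumes "S \<subseteq> topspace T"
    and "\<And>x. x \<in> S \<Longrightarrow> \<exists>U. openin T U \<and> S \<inter> U = {x}"
  shows "discrete_subspace T S"
proof -
  have "openin (subtopology T S) {x}" if "x \<in> S" for x
    using assms(2)[OF that] by (auto simp: openin_subtopology)
  moreover have "topspace (subtopology T S) = S"
    using assms(1) by auto
  ultimately show ?thesis
    unfolding discrete_subspace_def
    by (metis discrete_topology_unique)
qed

text \<open>Every valuation domain contains \<open>1\<close>, so the whole space is itself a
  generator. This identifies \<open>topspace\<close>, which for a generated topology is the union of
  the generators.\<close>

lemma basic_open_1: "basic_open V 1 = Zar V"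
  by (auto simp: basic_open_def Zar_def valuation_domain_def)

lemma topspace_zariski [simp]: "topspace (zariski_topology V) = Zar V"
proof
  show "topspace (zariski_topology V) \<subseteq> Zar V"
    unfolding zariski_topology_def topology_generated_by_topspace by (auto simp: basic_open_def)
  have "basic_open V 1 \<subseteq> topspace (zariski_topology V)"
    unfolding zariski_topology_def topology_generated_by_topspace by blast
  then show "Zar V \<subseteq> topspace (zariski_topology V)"
    by (simp add: basic_open_1)
qed

lemma openin_zariski_basic: "openin (zariski_topology V) (basic_open V \<phi>)"
  unfolding zariski_topology_def by (rule topology_generated_by_Basis) simp

lemma basic_open_in_finite_basic_sets: "basic_open V \<phi> \<in> finite_basic_sets V"
  unfolding finite_basic_sets_def by (rule CollectI, rule exI[of _ "{\<phi>}"]) simp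

lemma topspace_constructible [simp]: "topspace (constructible_topology V) = Zar V"
proof -
  have "U \<subseteq> Zar V" if "U \<in> finite_basic_sets V" for U
    using that by (auto simp: finite_basic_sets_def basic_open_def)
  moreover have "Zar V \<in> finite_basic_sets V"
    using basic_open_in_finite_basic_sets[of V 1] by (simp add: basic_open_1)
  ultimately show ?thesis
    unfolding constructible_topology_def topology_generated_by_topspace by blast
qed

lemma openin_constructible_basic: "openin (constructible_topology V) (basic_open V \<phi>)"
  unfolding constructible_topology_def
  by (rule topology_generated_by_Basis) (simp add: basic_open_in_finite_basic_sets)

text \<open>The basic open set of a function that singles out \<open>W\<close> within
  \<open>S\<close> isolates \<open>W\<close>, and basic open sets are open in both topologies. One
  isolating function per point therefore settles both claims at once.\<close>

lemma discrete_in_Zar: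
  assumes "S \<subseteq> Zar V"
    and "\<And>W. W \<in> S \<Longrightarrow> \<exists>\<phi>\<in>W. \<forall>W'\<in>S. \<phi> \<in> W' \<longrightarrow> W' = W"
  shows "discrete_subspace (zariski_topology V) S \<and> discrete_subspace (constructible_topology V) S"
proof -
  have "\<exists>\<phi>. S \<inter> basic_open V \<phi> = {W}" if W: "W \<in> S" for W
  proof -
    obtain \<phi> where "\<phi> \<in> W" "\<forall>W'\<in>S. \<phi> \<in> W' \<longrightarrow> W' = W"
      using assms(2)[OF W] by blast
    then have "S \<inter> basic_open V \<phi> = {W}"
      using assms(1) W unfolding basic_open_def by blast
    then show ?thesis ..
  qed
  then have isolated: "\<exists>U. openin T U \<and> S \<inter> U = {W}"
    if "W \<in> S" "\<And>\<phi>. openin T (basic_open V \<phi>)" for W T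
    using that by blast
  show ?thesis
    using assms(1) isolated
    by (intro conjI discrete_subspaceI)
      (simp_all add: openin_zariski_basic openin_constructible_basic)
qed

section \<open>Rational functions along injective sequences, and real valuations\<close>

text \<open>An injective sequence meets the finitely many roots of \<open>q\<close> at only finitely
  many indices. Hence any representation of the function may be evaluated, reduced or not, and
  division by zero affects only finitely many \<open>n\<close>.\<close>

lemma seq_domain_Fract_iff:
  assumes "inj s" "q \<noteq> 0"
  shows "Fract p q \<in> seq_domain V s \<longleftrightarrow> (\<forall>\<^sub>\<infinity>n. poly p (s n) / poly q (s n) \<in> V)"
proof -
  have "finite (s -` {x. poly q x = 0})"
    using assms by (intro finite_vimageI poly_roots_finite)
  then have ev: "\<forall>\<^sub>\<infinity>n. poly q (s n) \<noteq> 0"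
    by (simp add: eventually_cofinite vimage_def)
  have eq: "\<forall>\<^sub>\<infinity>n. (defined_at (Fract p q) (s n) \<and> ratfun_eval (Fract p q) (s n) \<in> V)
              \<longleftrightarrow> poly p (s n) / poly q (s n) \<in> V"
    using ev
  proof eventually_elim
    case (elim n)
    then have "defined_at (Fract p q) (s n)"
      unfolding defined_at_def by blast
    then show ?case
      using ratfun_eval_Fract[OF elim] by simp
  qed
  show ?thesis
    unfolding seq_domain_def mem_Collect_eq by (rule eventually_subst[OF eq])
qed

locale real_valued =
  fixes V :: "'k::field set" and v :: "'k \<Rightarrow> ereal"
  assumes assoc: "associated_real_valuation V v"
begin

lemma v_0 [simp]: "v 0 = \<infinity>"
  and v_finite: "x \<noteq> 0 \<Longrightarrow> \<bar>v x\<bar> \<noteq> \<infinity>"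
  and v_mult: "v (x * y) = v x + v y"
  and v_add: "min (v x) (v y) \<le> v (x + y)"
  and V_eq: "V = {x. 0 \<le> v x}"
  by (insert assoc, simp_all add: associated_real_valuation_def)

lemma v_1 [simp]: "v 1 = 0"
  using v_mult[of 1 1] v_finite[of 1] by (cases "v 1") auto

lemma v_minus [simp]: "v (- x) = v x"
proof -
  have "v (- 1) = 0"
    using v_mult[of "- 1" "- 1"] v_finite[of "- 1"] by (cases "v (- 1)") auto
  then show ?thesis
    using v_mult[of "- 1" x] by simp
qed

lemma v_commute: "v (x - y) = v (y - x)"
  using v_minus[of "x - y"] by simp

lemma v_inverse: "x \<noteq> 0 \<Longrightarrow> v (inverse x) = - v x"
  using v_mult[of x "inverse x"] v_finite[of x] v_finite[of "inverse x"]
  by (cases "v x"; cases "v (inverse x)") (auto simp: zero_ereal_def one_ereal_def)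

lemma v_divide: "y \<noteq> 0 \<Longrightarrow> v (x / y) = v x - v y"
  by (simp add: divide_inverse v_mult v_inverse minus_ereal_def)

lemma v_add_ge: "g \<le> v x \<Longrightarrow> g \<le> v y \<Longrightarrow> g \<le> v (x + y)"
  using v_add[of x y] by (meson min.boundedI order_trans)

lemma v_diff_trans: "g \<le> v (x - y) \<Longrightarrow> g \<le> v (y - z) \<Longrightarrow> g \<le> v (x - z)"
  using v_add_ge[of g "x - y" "y - z"] by simp

lemma v_add_less:
  assumes "v x < v y"
  shows "v (x + y) = v x"
proof (rule antisym)
  show "v x \<le> v (x + y)"
    using assms by (intro v_add_ge) auto
  have "min (v (x + y)) (v y) \<le> v x"
    using v_add[of "x + y" "- y"] by simp
  then show "v (x + y) \<le> v x"
    using assms by (auto simp: min_def split: if_splits)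
qed

lemma valuation_domain_V: "valuation_domain V"
  unfolding valuation_domain_def
proof (intro conjI allI impI ballI)
  show "1 \<in> V" by (simp add: V_eq)
next
  fix x y assume xy: "x \<in> V" "y \<in> V"
  then show "x - y \<in> V"
    using v_add_ge[of 0 x "- y"] by (simp add: V_eq)
  show "x * y \<in> V"
    using xy by (simp add: V_eq v_mult)
next
  fix x :: 'k assume "x \<noteq> 0"
  then show "x \<in> V \<or> inverse x \<in> V"
    by (cases "v x") (auto simp: V_eq v_inverse)
qed

section \<open>Values of polynomials on a disc\<close>

text \<open>Induction on the degree, writing p = (X - a) q + p(a) for one of the points
  \<open>a\<close>. Exact distance \<delta> makes the bound for q at the other points precisely g -
  \<delta>; multiplying by t - a, of value at least \<delta>, restores g. The bound changes on the
  way, so \<open>g\<close> is generalised in the induction.\<close>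

lemma poly_value_ge_on_disc:
  assumes "finite A" "degree p < card A"
    and "\<And>a b. a \<in> A \<Longrightarrow> b \<in> A \<Longrightarrow> a \<noteq> b \<Longrightarrow> v (a - b) = ereal \<delta>"
    and "\<And>a. a \<in> A \<Longrightarrow> ereal \<delta> \<le> v (t - a)"
    and "\<And>a. a \<in> A \<Longrightarrow> g \<le> v (poly p a)"
  shows "g \<le> v (poly p t)"
  using assms
proof (induction "degree p" arbitrary: p A g)
  case 0
  then obtain c where "p = [:c:]"
    by (metis degree_eq_zeroE)
  moreover obtain a where "a \<in> A"
    using 0 by fastforce
  ultimately show ?case
    using "0.prems"(5)[of a] by simp
next
  case (Suc d)
  obtain a where a: "a \<in> A"
    using Suc.prems(2) by fastforce
  define q where "q = synthetic_div p a"
  have poly_p: "poly p x = (x - a) * poly q x + poly p a" for x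
  proof -
    have "poly p x = poly ([:- a, 1:] * q + [:poly p a:]) x"
      by (simp only: q_def synthetic_div_correct')
    then show ?thesis by (simp add: algebra_simps)
  qed
  have "degree q = d"
    using Suc.hyps(2) by (simp add: q_def degree_synthetic_div)
  have "g - ereal \<delta> \<le> v (poly q t)"
  proof (rule Suc.hyps(1)[of q "A - {a}"])
    show "d = degree q" using \<open>degree q = d\<close> by simp
    show "degree q < card (A - {a})"
      using Suc a \<open>degree q = d\<close> by simp
    fix b assume b: "b \<in> A - {a}"
    have "g \<le> v (poly p b - poly p a)"
      using v_add_ge[of g "poly p b" "- poly p a"] Suc.prems(5) a b by simp
    also have "\<dots> = v (b - a) + v (poly q b)"
      using poly_p[of b] by (simp add: v_mult)
    also have "v (b - a) = ereal \<delta>"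
      using Suc.prems(3) a b by simp
    finally show "g - ereal \<delta> \<le> v (poly q b)"
      by (simp add: ereal_minus_le_iff add.commute)
  qed (use Suc.prems in auto)
  then have "g \<le> ereal \<delta> + v (poly q t)"
    by (simp add: ereal_minus_le_iff add.commute)
  also have "\<dots> \<le> v ((t - a) * poly q t)"
    using Suc.prems(4)[OF a] by (simp add: v_mult add_right_mono)
  finally show ?case
    unfolding poly_p[of t] using v_add_ge Suc.prems(5)[OF a] by blast
qed

section \<open>Pseudo-stationary sequences in a disc\<close>

lemma pseudo_stationary_breadth:
  assumes "pseudo_stationary v s" "n \<noteq> m"
  shows "v (s n - s m) = breadth v s"
proof -
  have "breadth v s = v (s n - s m)"
    unfolding breadth_def
    by (rule the_equality) (use assms in \<open>unfold pseudo_stationary_def, blast+\<close>)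
  then show ?thesis by simp
qed

lemma breadth_finite:
  assumes "pseudo_stationary v s"
  obtains \<delta> where "breadth v s = ereal \<delta>"
proof -
  have "s 0 - s 1 \<noteq> 0"
    using assms by (auto simp: pseudo_stationary_def dest: injD)
  then show ?thesis
    using pseudo_stationary_breadth[OF assms, of 0 1] v_finite[of "s 0 - s 1"] that
    by (cases "breadth v s") auto
qed

text \<open>The disc of the x with v(x - \<alpha>) \<ge> \<delta> has radius equal to the breadth,
  so it is the set of pseudo-limits of \<open>s\<close>. Any of its points may serve as centre:
  below it is \<open>s 0\<close> or \<beta>.\<close>

definition stationary_in :: "'k \<Rightarrow> real \<Rightarrow> (nat \<Rightarrow> 'k) \<Rightarrow> bool" where
  "stationary_in \<alpha> \<delta> s \<longleftrightarrow>
     pseudo_stationary v s \<and> breadth v s = ereal \<delta> \<and> (\<forall>n. ereal \<delta> \<le> v (s n - \<alpha>))"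

lemma stationary_in_inj: "stationary_in \<alpha> \<delta> s \<Longrightarrow> inj s"
  by (simp add: stationary_in_def pseudo_stationary_def)

text \<open>Carries a bound from finitely many terms of one sequence to every point of the disc, in
  particular to the terms of any other sequence in it.\<close>

lemma stationary_in_poly_value_ge:
  assumes s: "stationary_in \<alpha> \<delta> s" and t: "ereal \<delta> \<le> v (t - \<alpha>)"
    and N: "finite N" "degree p < card N" "\<And>n. n \<in> N \<Longrightarrow> g \<le> v (poly p (s n))"
  shows "g \<le> v (poly p t)"
proof (rule poly_value_ge_on_disc[of "s ` N"])
  show "degree p < card (s ` N)"
    using N(2) stationary_in_inj[OF s] by (simp add: card_image inj_on_subset)
  show "v (a - b) = ereal \<delta>" if "a \<in> s ` N" "b \<in> s ` N" "a \<noteq> b" for a b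
    using that pseudo_stationary_breadth[of s] s by (metis imageE stationary_in_def)
  show "ereal \<delta> \<le> v (t - a)" if "a \<in> s ` N" for a
    using that s t by (auto simp: stationary_in_def v_commute[of \<alpha>] intro: v_diff_trans[of _ t \<alpha>])
qed (use N in auto)

text \<open>The real \<open>g\<close> is chosen before the sequence: it is the minimum of the value
  of \<open>p\<close> on the disc, the same for all sequences in it. Without any such sequence the
  claim is vacuous.\<close>

lemma eventually_poly_value:
  assumes "p \<noteq> 0"
  shows "\<exists>g::real. \<forall>s. stationary_in \<alpha> \<delta> s \<longrightarrow> (\<forall>\<^sub>\<infinity>n. v (poly p (s n)) = ereal g)"
proof (cases "\<exists>s. stationary_in \<alpha> \<delta> s")
  case True
  then obtain s where s: "stationary_in \<alpha> \<delta> s" by blast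
  let ?w = "\<lambda>n. v (poly p (s n))"
  \<comment> \<open>The indices up to \<open>degree p\<close> give \<open>degree p + 1\<close>
    terms, one more than the degree, so the least value among them, attained at \<open>s k\<close>,
    bounds \<open>p\<close> on the whole disc.\<close>
  have "Min (?w ` {..degree p}) \<in> ?w ` {..degree p}"
    by (intro Min_in) auto
  then obtain k where k: "?w k = Min (?w ` {..degree p})"
    by fastforce
  have ge: "?w k \<le> v (poly p t)" if "ereal \<delta> \<le> v (t - \<alpha>)" for t
    by (rule stationary_in_poly_value_ge[OF s that, of "{..degree p}"]) (auto simp: k)
  \<comment> \<open>The minimum is a real number and not \<infinity>: a term that is not a root has
    finite value, and the minimum is at most that value.\<close>
  have "\<exists>n. poly p (s n) \<noteq> 0"
  proof (rule ccontr)
    assume "\<nexists>n. poly p (s n) \<noteq> 0"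
    then have "range s \<subseteq> {x. poly p x = 0}" by auto
    then show False
      using poly_roots_finite[OF assms] stationary_in_inj[OF s]
      by (meson finite_imageD finite_subset infinite_UNIV_nat)
  qed
  then obtain n where "poly p (s n) \<noteq> 0" by blast
  moreover have "?w k \<le> ?w n"
    using ge s by (simp add: stationary_in_def)
  ultimately have "poly p (s k) \<noteq> 0"
    using v_finite by fastforce
  then obtain g where g: "?w k = ereal g"
    using v_finite[of "poly p (s k)"] by (cases "?w k") auto
  have "\<forall>\<^sub>\<infinity>n. v (poly p (t n)) = ereal g" if t: "stationary_in \<alpha> \<delta> t" for t
  proof (rule ccontr)
    assume "\<not> (\<forall>\<^sub>\<infinity>n. v (poly p (t n)) = ereal g)"
    then have "infinite {n. v (poly p (t n)) \<noteq> ereal g}"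
      by (simp add: eventually_cofinite)
    \<comment> \<open>On \<open>degree p + 1\<close> exceptional terms all values exceed the minimum
      \<open>g\<close>, hence so does the least of them; this lower bound would carry over to
      \<open>s k\<close>, where the value is \<open>g\<close>.\<close>
    then obtain N where N: "N \<subseteq> {n. v (poly p (t n)) \<noteq> ereal g}" "finite N"
        "card N = Suc (degree p)"
      using infinite_arbitrarily_large by blast
    let ?M = "(\<lambda>n. v (poly p (t n))) ` N"
    have ne: "?M \<noteq> {}" using N by auto
    have "Min ?M \<le> v (poly p (s k))"
      by (rule stationary_in_poly_value_ge[OF t _ N(2)])
        (use s N in \<open>auto simp: stationary_in_def\<close>)
    moreover have "ereal g < v (poly p (t n))" if "n \<in> N" for n
      using that N(1) ge[of "t n"] t by (force simp: stationary_in_def g)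
    ultimately show False
      using Min_in[OF finite_imageI[OF N(2)] ne] g by fastforce
  qed
  then show ?thesis by blast
qed blast

lemma eventually_fraction_value:
  assumes "p \<noteq> 0" "q \<noteq> 0"
  shows "\<exists>g::real. \<forall>s. stationary_in \<alpha> \<delta> s \<longrightarrow>
           (\<forall>\<^sub>\<infinity>n. v (poly p (s n) / poly q (s n)) = ereal g)"
proof -
  obtain a where a: "\<And>s. stationary_in \<alpha> \<delta> s \<Longrightarrow> \<forall>\<^sub>\<infinity>n. v (poly p (s n)) = ereal a"
    using eventually_poly_value[OF assms(1)] by blast
  obtain b where b: "\<And>s. stationary_in \<alpha> \<delta> s \<Longrightarrow> \<forall>\<^sub>\<infinity>n. v (poly q (s n)) = ereal b"
    using eventually_poly_value[OF assms(2)] by blast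
  have "\<forall>\<^sub>\<infinity>n. v (poly p (s n) / poly q (s n)) = ereal (a - b)" if "stationary_in \<alpha> \<delta> s" for s
    using a[OF that] b[OF that]
  proof eventually_elim
    case (elim n)
    then have "poly q (s n) \<noteq> 0" by auto
    then show ?case using elim by (simp add: v_divide)
  qed
  then show ?thesis by blast
qed

text \<open>A nonzero function has the same eventual value \<open>g\<close> along both sequences, so
  membership amounts to \<open>0 \<le> g\<close> for each. Exchanging the sequences gives
  equality.\<close>

lemma seq_domain_subset_of_disc:
  assumes s: "stationary_in \<alpha> \<delta> s" and t: "stationary_in \<alpha> \<delta> t"
  shows "seq_domain V s \<subseteq> seq_domain V t"
proof
  fix \<phi> assume \<phi>: "\<phi> \<in> seq_domain V s"
  obtain p q where pq: "\<phi> = Fract p q" "q \<noteq> 0" by (rule Fract_cases)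
  note iff = seq_domain_Fract_iff[OF stationary_in_inj pq(2)]
  show "\<phi> \<in> seq_domain V t"
  \<comment> \<open>The zero function has value \<infinity>, so it has no real eventual value and is
    treated apart.\<close>
  proof (cases "p = 0")
    case True
    then show ?thesis by (simp add: pq(1) iff[OF t] V_eq)
  next
    case False
    then obtain g where
      g: "\<And>s. stationary_in \<alpha> \<delta> s \<Longrightarrow> \<forall>\<^sub>\<infinity>n. v (poly p (s n) / poly q (s n)) = ereal g"
      using eventually_fraction_value[OF _ pq(2)] by blast
    have "\<forall>\<^sub>\<infinity>n. poly p (s n) / poly q (s n) \<in> V"
      using \<phi> by (simp add: pq(1) iff[OF s])
    with g[OF s] have "\<forall>\<^sub>\<infinity>n::nat. 0 \<le> g"
      by eventually_elim (auto simp: V_eq)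
    then have "0 \<le> g" by simp
    have "\<forall>\<^sub>\<infinity>n. poly p (t n) / poly q (t n) \<in> V"
      using g[OF t] by eventually_elim (simp add: V_eq \<open>0 \<le> g\<close>)
    then show ?thesis by (simp add: pq(1) iff[OF t])
  qed
qed

lemma seq_domain_eq_of_disc:
  "stationary_in \<alpha> \<delta> s \<Longrightarrow> stationary_in \<alpha> \<delta> t \<Longrightarrow> seq_domain V s = seq_domain V t"
  by (simp add: seq_domain_subset_of_disc subset_antisym)

section \<open>\<open>V_E\<close> as a point of the Zariski space\<close>

lemma stationary_in_first:
  assumes "pseudo_stationary v s" "breadth v s = ereal \<delta>"
  shows "stationary_in (s 0) \<delta> s"
  unfolding stationary_in_def
proof (intro conjI assms allI)
  fix n show "ereal \<delta> \<le> v (s n - s 0)"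
    by (cases "n = 0") (use pseudo_stationary_breadth[OF assms(1)] assms(2) in auto)
qed

text \<open>One term in the disc brings in all others, since they lie at distance \<delta> from
  it.\<close>

lemma stationary_inI:
  assumes s: "pseudo_stationary v s" "breadth v s = ereal \<delta>"
    and m: "ereal \<delta> \<le> v (s m - \<alpha>)"
  shows "stationary_in \<alpha> \<delta> s"
  unfolding stationary_in_def
proof (intro conjI s allI)
  fix n show "ereal \<delta> \<le> v (s n - \<alpha>)"
    using pseudo_stationary_breadth[OF s(1), of n m] s(2) m
      v_diff_trans[of "ereal \<delta>" "s n" "s m" \<alpha>]
    by (cases "n = m") auto
qed

text \<open>Closure under difference and product is checked term by term. That a function or its
  inverse belongs to the ring follows from the sign of its constant eventual value.\<close>

lemma seq_domain_in_Zar: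
  assumes "pseudo_stationary v s"
  shows "seq_domain V s \<in> Zar V"
proof -
  obtain \<delta> where "breadth v s = ereal \<delta>"
    using breadth_finite[OF assms] .
  then have s: "stationary_in (s 0) \<delta> s"
    using stationary_in_first assms by blast
  note iff = seq_domain_Fract_iff[OF stationary_in_inj[OF s]]
  have V1: "1 \<in> V" and Vd: "\<And>x y. x \<in> V \<Longrightarrow> y \<in> V \<Longrightarrow> x - y \<in> V"
    and Vm: "\<And>x y. x \<in> V \<Longrightarrow> y \<in> V \<Longrightarrow> x * y \<in> V"
    using valuation_domain_V unfolding valuation_domain_def by blast+
  have const: "const_ratfun a \<in> seq_domain V s" if "a \<in> V" for a
    unfolding const_ratfun_def using that by (simp add: iff)
  have nz: "\<forall>\<^sub>\<infinity>n. poly q (s n) \<noteq> 0" if "q \<noteq> 0" for q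
    using finite_vimageI[OF poly_roots_finite[OF that] stationary_in_inj[OF s]]
    by (simp add: eventually_cofinite vimage_def)
  have "valuation_domain (seq_domain V s)"
    unfolding valuation_domain_def
  proof (intro conjI ballI allI impI)
    show "1 \<in> seq_domain V s"
      using const[OF V1] by (simp add: const_ratfun_def One_fract_def one_pCons)
  next
    fix \<phi> \<psi> assume mem: "\<phi> \<in> seq_domain V s" "\<psi> \<in> seq_domain V s"
    obtain p q where \<phi>: "\<phi> = Fract p q" "q \<noteq> 0" by (rule Fract_cases)
    obtain p' q' where \<psi>: "\<psi> = Fract p' q'" "q' \<noteq> 0" by (rule Fract_cases)
    have ev: "\<forall>\<^sub>\<infinity>n. poly p (s n) / poly q (s n) \<in> V" "\<forall>\<^sub>\<infinity>n. poly p' (s n) / poly q' (s n) \<in> V"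
      using mem by (simp_all add: \<phi> \<psi> iff)
    have "\<forall>\<^sub>\<infinity>n. poly (p * q' - p' * q) (s n) / poly (q * q') (s n) \<in> V"
      using ev nz[OF \<phi>(2)] nz[OF \<psi>(2)]
    proof eventually_elim
      case (elim n)
      have "poly (p * q' - p' * q) (s n) / poly (q * q') (s n) =
            poly p (s n) / poly q (s n) - poly p' (s n) / poly q' (s n)"
        using elim by (simp add: field_simps)
      then show ?case using Vd elim by simp
    qed
    then show "\<phi> - \<psi> \<in> seq_domain V s"
      using \<phi> \<psi> by (simp add: iff)
    have "\<forall>\<^sub>\<infinity>n. poly (p * p') (s n) / poly (q * q') (s n) \<in> V"
      using ev by eventually_elim (metis Vm poly_mult times_divide_times_eq)
    then show "\<phi> * \<psi> \<in> seq_domain V s"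
      using \<phi> \<psi> by (simp add: iff)
  next
    fix \<phi> :: "'k ratfun" assume "\<phi> \<noteq> 0"
    obtain p q where \<phi>: "\<phi> = Fract p q" "q \<noteq> 0" by (rule Fract_cases)
    have "p \<noteq> 0" using \<open>\<phi> \<noteq> 0\<close> \<phi> by (auto simp: fract_collapse)
    obtain g where g: "\<forall>\<^sub>\<infinity>n. v (poly p (s n) / poly q (s n)) = ereal g"
      using eventually_fraction_value[OF \<open>p \<noteq> 0\<close> \<phi>(2)] s by blast
    show "\<phi> \<in> seq_domain V s \<or> inverse \<phi> \<in> seq_domain V s"
    proof (cases "0 \<le> g")
      case True
      have "\<forall>\<^sub>\<infinity>n. poly p (s n) / poly q (s n) \<in> V"
        using g by eventually_elim (simp add: V_eq True)
      then show ?thesis by (simp add: \<phi> iff)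
    next
      case False
      have "\<forall>\<^sub>\<infinity>n. poly q (s n) / poly p (s n) \<in> V"
        using g nz[OF \<open>p \<noteq> 0\<close>] nz[OF \<phi>(2)]
      proof eventually_elim
        case (elim n)
        then have "v (poly q (s n) / poly p (s n)) = - ereal g"
          using v_inverse[of "poly p (s n) / poly q (s n)"] by simp
        then show ?case using False by (simp add: V_eq)
      qed
      then show ?thesis by (simp add: \<phi> iff \<open>p \<noteq> 0\<close>)
    qed
  qed
  with const show ?thesis by (auto simp: Zar_def)
qed

section \<open>Fixed breadth\<close>

lemma discrete_V_stat_breadth:
  "discrete_subspace (zariski_topology V) (V_stat_breadth V v \<delta>) \<and>
   discrete_subspace (constructible_topology V) (V_stat_breadth V v \<delta>)"
proof (rule discrete_in_Zar)
  show "V_stat_breadth V v \<delta> \<subseteq> Zar V"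
    using seq_domain_in_Zar by (auto simp: V_stat_breadth_def)
next
  fix W assume "W \<in> V_stat_breadth V v \<delta>"
  then obtain s where W: "W = seq_domain V s" and s: "pseudo_stationary v s" "breadth v s = ereal \<delta>"
    by (auto simp: V_stat_breadth_def)
  \<comment> \<open>A difference of two terms realises the breadth as a value; dividing by it turns
    "value at least \<delta>" into membership in \<open>V\<close>.\<close>
  define c where "c = s 1 - s 0"
  have vc: "v c = ereal \<delta>"
    using pseudo_stationary_breadth[OF s(1), of 1 0] s(2) by (simp add: c_def)
  then have c: "c \<noteq> 0" by auto
  let ?\<phi> = "Fract [:- s 0, 1:] [:c:]"
  have mem: "?\<phi> \<in> seq_domain V t \<longleftrightarrow> (\<forall>\<^sub>\<infinity>n. ereal \<delta> \<le> v (t n - s 0))"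
    if "pseudo_stationary v t" for t
  proof -
    have "inj t" using that by (simp add: pseudo_stationary_def)
    moreover have "0 \<le> v ((x - s 0) / c) \<longleftrightarrow> ereal \<delta> \<le> v (x - s 0)" for x
      using c by (cases "v (x - s 0)") (auto simp: v_divide vc)
    ultimately show ?thesis using c by (simp add: seq_domain_Fract_iff V_eq)
  qed
  have st: "stationary_in (s 0) \<delta> s"
    using stationary_in_first[OF s] .
  then have "?\<phi> \<in> W"
    using mem[OF s(1)] by (simp add: W stationary_in_def)
  moreover have "W' = W" if W': "W' \<in> V_stat_breadth V v \<delta>" "?\<phi> \<in> W'" for W'
  proof -
    obtain t where t: "W' = seq_domain V t" "pseudo_stationary v t" "breadth v t = ereal \<delta>"
      using W'(1) by (auto simp: V_stat_breadth_def)
    then have "\<forall>\<^sub>\<infinity>n. ereal \<delta> \<le> v (t n - s 0)"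
      using mem W'(2) by blast
    \<comment> \<open>A single term of \<open>t\<close> in the disc around \<open>s 0\<close>
      suffices: equal breadth then puts both sequences in the same disc.\<close>
    then obtain m where "ereal \<delta> \<le> v (t m - s 0)"
      using eventually_happens'[OF sequentially_bot] unfolding cofinite_eq_sequentially by blast
    then show ?thesis
      using seq_domain_eq_of_disc[OF stationary_inI st] t W by blast
  qed
  ultimately show "\<exists>\<phi>\<in>W. \<forall>W'\<in>V_stat_breadth V v \<delta>. \<phi> \<in> W' \<longrightarrow> W' = W"
    by blast
qed

section \<open>Fixed pseudo-limit\<close>

text \<open>If v(x) is not 0, the summand of negative value determines the value of the sum. If v(x)
  = 0, cancellation can only raise the value above 0.\<close>

lemma v_add_inverse_ge_0_iff:
  assumes "x \<noteq> 0"
  shows "0 \<le> v (x + inverse x) \<longleftrightarrow> v x = 0"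
proof (cases "v x" "0 :: ereal" rule: linorder_cases)
  case less
  then have "v x < v (inverse x)"
    using v_inverse[OF assms] by (cases "v x") auto
  then show ?thesis using v_add_less less by auto
next
  case equal
  then show ?thesis using v_inverse[OF assms] v_add_ge[of 0 x "inverse x"] by simp
next
  case greater
  have "v (inverse x) < 0" "v (inverse x) < v x"
    using v_inverse[OF assms] greater by (cases "v x"; auto)+
  then show ?thesis using v_add_less[of "inverse x" x] greater by (auto simp: add.commute)
qed

text \<open>All sequences involved lie in discs centred at \<beta>, so their breadth alone
  determines \<open>V_E\<close>. The quotient (X - \<beta>)/c would only detect breadth at least
  \<delta>; adding its inverse also excludes larger breadths.\<close>

lemma discrete_V_stat_limit:
  "discrete_subspace (zariski_topology V) (V_stat_limit V v \<beta>) \<and>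
   discrete_subspace (constructible_topology V) (V_stat_limit V v \<beta>)"
proof (rule discrete_in_Zar)
  show "V_stat_limit V v \<beta> \<subseteq> Zar V"
    using seq_domain_in_Zar by (auto simp: V_stat_limit_def)
next
  have limit: "\<forall>\<^sub>\<infinity>n. v (s n - \<beta>) = breadth v s" if "\<beta> \<in> pseudo_limits v s" for s
    using that by (simp add: pseudo_limits_def cofinite_eq_sequentially v_commute)
  have disc: "stationary_in \<beta> \<delta> s"
    if s: "\<beta> \<in> pseudo_limits v s" "pseudo_stationary v s" "breadth v s = ereal \<delta>" for s \<delta>
  proof -
    obtain m where "v (s m - \<beta>) = breadth v s"
      using limit[OF s(1)] eventually_happens'[OF sequentially_bot] unfolding cofinite_eq_sequentially by blast
    then show ?thesis
      using stationary_inI s by (metis order_refl)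
  qed
  fix W assume "W \<in> V_stat_limit V v \<beta>"
  then obtain s where W: "W = seq_domain V s" and s: "pseudo_stationary v s" "\<beta> \<in> pseudo_limits v s"
    by (auto simp: V_stat_limit_def)
  obtain \<delta> where \<delta>: "breadth v s = ereal \<delta>"
    using breadth_finite[OF s(1)] .
  define c where "c = s 1 - s 0"
  have vc: "v c = ereal \<delta>"
    using pseudo_stationary_breadth[OF s(1), of 1 0] \<delta> by (simp add: c_def)
  then have c: "c \<noteq> 0" by auto
  \<comment> \<open>With x = (X - \<beta>)/c this is x + 1/x over the common denominator c(X -
    \<beta>).\<close>
  let ?\<phi> = "Fract ([:- \<beta>, 1:]\<^sup>2 + [:c\<^sup>2:]) (smult c [:- \<beta>, 1:])"
  have mem: "?\<phi> \<in> seq_domain V t \<longleftrightarrow> breadth v t = ereal \<delta>"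
    if t: "pseudo_stationary v t" "\<beta> \<in> pseudo_limits v t" for t
  proof -
    have inj: "inj t" using t by (simp add: pseudo_stationary_def)
    obtain \<epsilon> where \<epsilon>: "breadth v t = ereal \<epsilon>"
      using breadth_finite[OF t(1)] .
    have "\<forall>\<^sub>\<infinity>n. (poly ([:- \<beta>, 1:]\<^sup>2 + [:c\<^sup>2:]) (t n) / poly (smult c [:- \<beta>, 1:]) (t n) \<in> V)
            \<longleftrightarrow> \<epsilon> = \<delta>"
      using limit[OF t(2)]
    proof eventually_elim
      case (elim n)
      \<comment> \<open>The distance from \<open>t n\<close> to \<beta> has the finite value
        \<epsilon>, so \<open>t n\<close> differs from \<beta> and x below is invertible, of value
        \<epsilon> - \<delta>.\<close>
      then have nz: "t n - \<beta> \<noteq> 0" by (auto simp: \<epsilon>)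
      define x where "x = (t n - \<beta>) / c"
      have x: "x \<noteq> 0" "v x = ereal (\<epsilon> - \<delta>)"
        using nz c elim by (simp_all add: x_def v_divide vc \<epsilon>)
      have "poly ([:- \<beta>, 1:]\<^sup>2 + [:c\<^sup>2:]) (t n) / poly (smult c [:- \<beta>, 1:]) (t n) =
            ((t n - \<beta>)\<^sup>2 + c\<^sup>2) / (c * (t n - \<beta>))"
        by (simp add: algebra_simps power2_eq_square)
      also have "\<dots> = x + inverse x"
        using nz c by (simp add: x_def add_divide_distrib power2_eq_square)
      finally show ?case
        using v_add_inverse_ge_0_iff[OF x(1)] x(2) by (simp add: V_eq zero_ereal_def)
    qed
    \<comment> \<open>The condition \<epsilon> = \<delta> does not involve \<open>n\<close>, so
      holding for almost all \<open>n\<close> means holding outright.\<close>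
    from eventually_cong[OF this] show ?thesis
      using c by (simp add: seq_domain_Fract_iff[OF inj] \<epsilon>)
  qed
  have "?\<phi> \<in> W"
    using mem s \<delta> W by blast
  moreover have "W' = W" if W': "W' \<in> V_stat_limit V v \<beta>" "?\<phi> \<in> W'" for W'
  proof -
    obtain t where t: "W' = seq_domain V t" "pseudo_stationary v t" "\<beta> \<in> pseudo_limits v t"
      using W'(1) by (auto simp: V_stat_limit_def)
    then have "breadth v t = ereal \<delta>"
      using mem W'(2) by blast
    then show ?thesis
      using seq_domain_eq_of_disc[OF disc disc] t s \<delta> W by blast
  qed
  ultimately show "\<exists>\<phi>\<in>W. \<forall>W'\<in>V_stat_limit V v \<beta>. \<phi> \<in> W' \<longrightarrow> W' = W"
    by blast
qed

end

theorem proposition5p6: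
  fixes V :: "'k::field set" and v :: "'k \<Rightarrow> ereal"
  assumes "valuation_domain V"
    and "rank_one V"
    and "associated_real_valuation V v"
  shows "(\<forall>\<delta>\<in>value_group v.
            discrete_subspace (zariski_topology V) (V_stat_breadth V v \<delta>) \<and>
            discrete_subspace (constructible_topology V) (V_stat_breadth V v \<delta>)) \<and>
         (\<forall>\<beta>. discrete_subspace (zariski_topology V) (V_stat_limit V v \<beta>) \<and>
            discrete_subspace (constructible_topology V) (V_stat_limit V v \<beta>))"
proof -
  interpret real_valued V v
    using assms(3) by unfold_locales
  show ?thesis
    using discrete_V_stat_breadth discrete_V_stat_limit by blast
qed

end
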